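(* Let $x_0\in\mathbb{C}$ and let $f$ be an entire function satisfying $$\limsup_{r\to\infty}\frac{\ln^+M(r;f)}{\sqrt r}<2\ln2.$$ Then there exists a unique sequence of complex numbers $\{a_n\}_{n\ge0}$, given by $$a_n=\frac1{n!}\sum_{j=0}^n(-1)^{n-j}\binom nj\frac{1}{(-2z_0i+j)_j\,(-2z_0i+2j+1)_{n-j}}f\left(x_0^{+(2j)}\right),$$ such that the Wilson series $\sum_{k=0}^\infty a_k\tau_k(x;x_0)$ converges uniformly to $f$ on every compact subset of $\mathbb{C}$.
   Context: $M(r;f)=\max_{|x|=r}|f(x)|$ and $\ln^+t=\max\{\ln t,0\}$ (with $\ln^+0=0$). $z_0$ is the square root of $x_0$ with $\arg z_0\in(-\frac\pi2,\frac\pi2]$ if $x_0\ne0$, and $z_0=0$ if $x_0=0$ (so $2z_0i\notin\{1,2,3,\dots\}$). $x_0^{+(2j)}:=(z_0+ji)^2$. $(a)_k:=a(a+1)\cdots(a+k-1)$ is the rising factorial, $(a)_0=1$. The Wilson basis at $x_0$ is $\tau_0(x;x_0)=1$ and $\tau_k(x;x_0)=\prod_{j=0}^{k-1}[(z_0+ji)^2-x]$ for $k\ge1$. *)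

theory Defs
  imports "HOL-Complex_Analysis.Complex_Analysis"
begin

(* For r >= 0 and continuous f the supremum is attained, so it is the maximum. *)
definition max_modulus :: "real \<Rightarrow> (complex \<Rightarrow> complex) \<Rightarrow> real" where
  "max_modulus r f = (SUP x\<in>sphere 0 r. norm (f x))"

definition ln_plus :: "real \<Rightarrow> real" where
  "ln_plus t = (if t = 0 then 0 else max (ln t) 0)"

(* The square root z0 of x0 with argument in (-pi/2, pi/2] is csqrt x0; note csqrt 0 = 0. *)
lemma csqrt_eq_iff_Arg:
  "z = csqrt x \<longleftrightarrow> z\<^sup>2 = x \<and> (x \<noteq> 0 \<longrightarrow> - pi / 2 < Arg z \<and> Arg z \<le> pi / 2)"
proof (cases "x = 0")
  case True
  then show ?thesis by auto
next
  case False
  have A: "- pi / 2 < Arg w \<and> Arg w \<le> pi / 2 \<longleftrightarrow> 0 < Re w \<or> Re w = 0 \<and> 0 \<le> Im w"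
    if "w \<noteq> 0" for w
  proof -
    have "\<bar>Arg w\<bar> < pi / 2 \<longleftrightarrow> Re w > 0" "\<bar>Arg w\<bar> \<le> pi / 2 \<longleftrightarrow> Re w \<ge> 0"
      "0 \<le> Arg w \<longleftrightarrow> 0 \<le> Im w"
      using Arg_Re_pos[of w] Arg_Re_nonneg[of w] Arg_less_0[of w] that by auto
    then show ?thesis using pi_gt_zero by (smt (verit) field_sum_of_halves)
  qed
  have "z\<^sup>2 = x \<Longrightarrow> z \<noteq> 0" using False by auto
  moreover have "csqrt x \<noteq> 0" using False by simp
  ultimately show ?thesis
    using False A[of z] A[of "csqrt x"] csqrt_unique[of z x] csqrt_principal[of x] by auto
qed

(* The node x0^{+(2j)}. *)
definition wilson_node :: "complex \<Rightarrow> nat \<Rightarrow> complex" where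
  "wilson_node x0 j = (csqrt x0 + of_nat j * \<i>)\<^sup>2"

definition wilson_basis :: "nat \<Rightarrow> complex \<Rightarrow> complex \<Rightarrow> complex" where
  "wilson_basis k x x0 = (\<Prod>j<k. wilson_node x0 j - x)"

definition wilson_series_converges_to ::
    "(nat \<Rightarrow> complex) \<Rightarrow> complex \<Rightarrow> (complex \<Rightarrow> complex) \<Rightarrow> bool" where
  "wilson_series_converges_to a x0 f \<longleftrightarrow>
     (\<forall>K. compact K \<longrightarrow>
       uniform_limit K (\<lambda>n x. \<Sum>k<n. a k * wilson_basis k x x0) f sequentially)"

end

theory Submission
  imports Defs "HOL-Real_Asymp.Real_Asymp"
begin

text \<open>
  A Wilson series is a Newton interpolation series with the nodes
  \<open>x\<^sub>j = (z\<^sub>0 + ji)\<^sup>2\<close>. The branch of the square root makes these nodes distinct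
  (\<open>inj_wilson_node\<close>), and at the node \<open>x\<^sub>m\<close> all basis functions with index above
  \<open>m\<close> vanish. Evaluating a convergent series at the nodes therefore gives a triangular system with
  nonzero diagonal for the coefficients, which proves uniqueness
  (\<open>newton_series_coeffs_unique\<close>).

  For existence, write \<open>N\<^sub>n(x) = (x\<^sub>0 - x) \<cdots> (x\<^bsub>n-1\<^esub> - x)\<close>. Expanding the Cauchy kernel
  along the nodes gives Hermite's formula: the error of the \<open>n\<close>-th partial sum at \<open>x\<close> is
  \<open>N\<^sub>n(x)\<close> times the Cauchy integral of \<open>f(t) / ((t - x) N\<^sub>n(t))\<close> over any circle
  around \<open>0\<close> which encloses \<open>x\<close> and \<open>x\<^sub>0, \<dots>, x\<^bsub>n-1\<^esub>\<close>
  (\<open>newton_expansion_with_remainder\<close>). Expanding \<open>1/N\<^sub>n\<^sub>+\<^sub>1\<close> into partial fractions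
  identifies the coefficients as explicit sums over the nodes, independent of the circle
  (\<open>newton_remainder_at_node\<close>).

  The nodes satisfy \<open>|x\<^sub>j| \<le> (j + b)\<^sup>2\<close> with a fixed integer \<open>b\<close>, so the circle of radius
  \<open>(n + b)\<^sup>2\<close> can be used. On it \<open>|N\<^sub>n| \<ge> (2n)!\<close>, because the differences
  \<open>(n + b)\<^sup>2 - (j + b)\<^sup>2\<close> factor, while on a fixed compact set \<open>|N\<^sub>n|\<close> is at most
  \<open>(n!)\<^sup>2\<close> up to a power of \<open>n\<close>. The quotient is of size \<open>4\<^sup>-\<^sup>n\<close>, again up to a power of
  \<open>n\<close>. The growth hypothesis yields some \<open>\<sigma> < 2 ln 2\<close> with
  \<open>|f| \<le> exp (\<sigma> (n + b))\<close> on the circle for all large \<open>n\<close>, and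
  \<open>exp \<sigma> < 4\<close> makes the product of these bounds tend to \<open>0\<close>
  (\<open>wilson_error_bound_tendsto_0\<close>).
\<close>

section \<open>Newton interpolation of entire functions\<close>

text \<open>
  Multiplied by the product of all \<open>X i - t\<close>, the right-hand side is the Lagrange interpolation
  polynomial of the constant \<open>1\<close>. It has degree below the number of nodes and takes the value
  \<open>1\<close> at each of them, so it is \<open>1\<close>.
\<close>
lemma partial_fractions_distinct_nodes:
  fixes X :: "'i \<Rightarrow> complex" and t :: complex
  assumes "finite S" "S \<noteq> {}" and inj: "inj_on X S" and t: "\<And>j. j \<in> S \<Longrightarrow> X j \<noteq> t"
  shows "1 / (\<Prod>i\<in>S. X i - t) = (\<Sum>j\<in>S. 1 / (\<Prod>i\<in>S - {j}. X i - X j) / (X j - t))"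
proof -
  define w where "w j = 1 / (\<Prod>i\<in>S - {j}. X i - X j)" for j
  define L where "L = (\<Sum>j\<in>S. smult (w j) (\<Prod>i\<in>S - {j}. [:X i, - 1:]))"
  have poly_L: "poly L y = (\<Sum>j\<in>S. w j * (\<Prod>i\<in>S - {j}. X i - y))" for y
    by (simp add: L_def poly_sum poly_prod)
  have "degree L \<le> card S - 1" unfolding L_def
  proof (intro degree_sum_le \<open>finite S\<close>)
    fix j assume "j \<in> S"
    have "degree (\<Prod>i\<in>S - {j}. [:X i, - 1:]) \<le> (\<Sum>i\<in>S - {j}. degree [:X i, - 1:])"
      using degree_prod_sum_le[of "S - {j}" "\<lambda>i. [:X i, - 1:]"] \<open>finite S\<close> by (simp add: o_def)
    also have "\<dots> = card S - 1" using \<open>j \<in> S\<close> by simp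
    finally show "degree (smult (w j) (\<Prod>i\<in>S - {j}. [:X i, - 1:])) \<le> card S - 1"
      using degree_smult_le le_trans by blast
  qed
  moreover have "card (X ` S) = card S" using inj by (rule card_image)
  moreover have "card S > 0" using assms by (simp add: card_gt_0_iff)
  ultimately have deg: "degree L < card (X ` S)" by linarith
  have "poly L y = poly 1 y" if "y \<in> X ` S" for y
  proof -
    obtain m where m: "m \<in> S" "y = X m" using \<open>y \<in> X ` S\<close> by blast
    have nz: "(\<Prod>i\<in>S - {m}. X i - X m) \<noteq> 0"
      using m inj \<open>finite S\<close> by (auto simp: inj_on_def)
    have "w j * (\<Prod>i\<in>S - {j}. X i - y) = (if j = m then 1 else 0)" if "j \<in> S" for j
    proof (cases "j = m")
      case False
      then have "m \<in> S - {j}" using m by auto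
      then have "(\<Prod>i\<in>S - {j}. X i - y) = 0" using m \<open>finite S\<close> by (intro prod_zero) auto
      then show ?thesis using False by simp
    qed (use nz m in \<open>simp add: w_def\<close>)
    then show ?thesis using m \<open>finite S\<close> by (simp add: poly_L)
  qed
  then have "L = 1"
    using deg by (intro poly_eqI_degree[of "X ` S"]) auto
  then have "1 = (\<Sum>j\<in>S. w j * (\<Prod>i\<in>S - {j}. X i - t))"
    using poly_L[of t] by simp
  then have "1 / (\<Prod>i\<in>S. X i - t) = (\<Sum>j\<in>S. w j * (\<Prod>i\<in>S - {j}. X i - t)) / (\<Prod>i\<in>S. X i - t)"
    by simp
  also have "\<dots> = (\<Sum>j\<in>S. w j / (X j - t))"
    unfolding sum_divide_distrib
  proof (rule sum.cong)
    fix j assume "j \<in> S"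
    then have "(\<Prod>i\<in>S. X i - t) = (X j - t) * (\<Prod>i\<in>S - {j}. X i - t)"
      using \<open>finite S\<close> by (rule prod.remove[rotated])
    moreover have "(\<Prod>i\<in>S - {j}. X i - t) \<noteq> 0" using t \<open>finite S\<close> by auto
    ultimately show "w j * (\<Prod>i\<in>S - {j}. X i - t) / (\<Prod>i\<in>S. X i - t) = w j / (X j - t)"
      by simp
  qed simp
  finally show ?thesis by (simp add: w_def)
qed

text \<open>
  This is \<open>(-1)\<^sup>n\<close> times the divided difference of \<open>f\<close> at \<open>X 0, \<dots>, X n\<close>; the sign comes
  from using the factors \<open>X j - x\<close> instead of \<open>x - X j\<close> in the Newton basis.
\<close>
definition newton_coeff :: "(nat \<Rightarrow> complex) \<Rightarrow> (complex \<Rightarrow> complex) \<Rightarrow> nat \<Rightarrow> complex" where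
  "newton_coeff X f n = (\<Sum>j\<le>n. f (X j) / (\<Prod>i\<in>{..n} - {j}. X i - X j))"

text \<open>
  Hermite's contour integral for the quotient of the interpolation error of the first \<open>n\<close> nodes
  by their node polynomial. Unlike that quotient, it makes sense when \<open>x\<close> is a node, and its value
  at the next node is the next Newton coefficient.
\<close>
definition newton_remainder ::
    "(nat \<Rightarrow> complex) \<Rightarrow> (complex \<Rightarrow> complex) \<Rightarrow> real \<Rightarrow> nat \<Rightarrow> complex \<Rightarrow> complex" where
  "newton_remainder X f R n x =
     contour_integral (circlepath 0 R) (\<lambda>t. f t / ((t - x) * (\<Prod>j<n. X j - t))) / (2 * pi * \<i>)"

lemma newton_kernel_has_integral:
  assumes f: "f holomorphic_on UNIV" and R: "R > 0" "norm x < R"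
    and X: "\<And>j. j < n \<Longrightarrow> norm (X j) < R"
  shows "((\<lambda>t. f t / ((t - x) * (\<Prod>j<n. X j - t))) has_contour_integral
           2 * pi * \<i> * newton_remainder X f R n x) (circlepath 0 R)"
proof -
  have "continuous_on (sphere 0 R) f"
    using f holomorphic_on_imp_continuous_on continuous_on_subset by blast
  moreover have "(t - x) * (\<Prod>j<n. X j - t) \<noteq> 0" if "t \<in> sphere 0 R" for t
    using that R X by fastforce
  ultimately have "continuous_on (sphere 0 R) (\<lambda>t. f t / ((t - x) * (\<Prod>j<n. X j - t)))"
    by (intro continuous_intros) auto
  then have "(\<lambda>t. f t / ((t - x) * (\<Prod>j<n. X j - t))) contour_integrable_on circlepath 0 R"
    using R by (intro contour_integrable_continuous_circlepath) (auto simp: path_image_circlepath)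
  then show ?thesis
    by (simp add: newton_remainder_def has_contour_integral_integral)
qed

text \<open>
  The case \<open>n = 0\<close> is Cauchy's formula. Each further step uses the identity
  \<open>1/(t - x) - 1/(t - X n) = (X n - x) / ((t - x) (X n - t))\<close> under the integral sign, which splits
  off the value of the remainder at \<open>X n\<close> as the next coefficient.
\<close>
lemma newton_expansion_with_remainder:
  assumes f: "f holomorphic_on UNIV" and R: "norm x < R"
    and X: "\<And>j. j < n \<Longrightarrow> norm (X j) < R"
  shows "f x = (\<Sum>k<n. newton_remainder X f R k (X k) * (\<Prod>j<k. X j - x))
               + (\<Prod>j<n. X j - x) * newton_remainder X f R n x"
  using X
proof (induction n)
  case 0
  have "f holomorphic_on cball 0 R" using f holomorphic_on_subset by blast
  then have "((\<lambda>t. f t / (t - x)) has_contour_integral 2 * of_real pi * \<i> * f x) (circlepath 0 R)"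
    using R by (intro Cauchy_integral_circlepath_simple) auto
  then show ?case
    by (simp add: newton_remainder_def contour_integral_unique)
next
  case (Suc n)
  have R0: "R > 0" using R norm_ge_zero[of x] by linarith
  have "((\<lambda>t. f t / ((t - x) * (\<Prod>j<n. X j - t)) - f t / ((t - X n) * (\<Prod>j<n. X j - t)))
          has_contour_integral 2 * pi * \<i> * newton_remainder X f R n x
            - 2 * pi * \<i> * newton_remainder X f R n (X n)) (circlepath 0 R)"
    by (intro has_contour_integral_diff newton_kernel_has_integral) (use f R R0 Suc in auto)
  then have A: "contour_integral (circlepath 0 R) (\<lambda>t. f t / ((t - x) * (\<Prod>j<n. X j - t))
             - f t / ((t - X n) * (\<Prod>j<n. X j - t)))
      = 2 * pi * \<i> * (newton_remainder X f R n x - newton_remainder X f R n (X n))"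
    by (simp add: contour_integral_unique algebra_simps)
  have "((\<lambda>t. (X n - x) * (f t / ((t - x) * (\<Prod>j<Suc n. X j - t))))
          has_contour_integral (X n - x) * (2 * pi * \<i> * newton_remainder X f R (Suc n) x))
          (circlepath 0 R)"
    by (intro has_contour_integral_lmul newton_kernel_has_integral) (use f R R0 Suc in auto)
  moreover have "(X n - x) * (f t / ((t - x) * (\<Prod>j<Suc n. X j - t)))
      = f t / ((t - x) * (\<Prod>j<n. X j - t)) - f t / ((t - X n) * (\<Prod>j<n. X j - t))"
    if "t \<in> path_image (circlepath 0 R)" for t
  proof -
    have t: "norm t = R" using that R0 by (auto simp: path_image_circlepath)
    have "t - x \<noteq> 0" "X n - t \<noteq> 0" "t - X n \<noteq> 0"
      using t R Suc.prems[of n] by auto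
    moreover have "(\<Prod>j<n. X j - t) \<noteq> 0" 
    proof -
      have "X j \<noteq> t" if "j < n" for j using that t Suc.prems[of j] by auto
      then show ?thesis by simp
    qed
    ultimately show ?thesis
      by (simp add: divide_simps) (simp add: algebra_simps)
  qed
  ultimately have "((\<lambda>t. f t / ((t - x) * (\<Prod>j<n. X j - t)) - f t / ((t - X n) * (\<Prod>j<n. X j - t)))
        has_contour_integral (X n - x) * (2 * pi * \<i> * newton_remainder X f R (Suc n) x))
        (circlepath 0 R)"
    by (rule has_contour_integral_eq)
  then have "2 * pi * \<i> * (newton_remainder X f R n x - newton_remainder X f R n (X n))
      = 2 * pi * \<i> * ((X n - x) * newton_remainder X f R (Suc n) x)"
    using A by (simp add: contour_integral_unique mult.left_commute)
  then have "newton_remainder X f R n x - newton_remainder X f R n (X n)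
      = (X n - x) * newton_remainder X f R (Suc n) x"
    by simp
  then have "newton_remainder X f R n x
      = newton_remainder X f R n (X n) + (X n - x) * newton_remainder X f R (Suc n) x"
    by (simp only: diff_eq_eq add.commute)
  moreover have "f x = (\<Sum>k<n. newton_remainder X f R k (X k) * (\<Prod>j<k. X j - x))
               + (\<Prod>j<n. X j - x) * newton_remainder X f R n x"
    using Suc by auto
  ultimately show ?case by (simp add: distrib_left mult.commute mult.left_commute)
qed

text \<open>
  The integrand is \<open>- f(t)\<close> divided by the product of all \<open>X j - t\<close> with \<open>j \<le> k\<close>. Partial
  fractions turn the integral into a combination of Cauchy integrals for the values \<open>f (X j)\<close>.
  In particular the value does not depend on \<open>R\<close>, so that the radius may grow with the number of
  nodes while the coefficients stay fixed.
\<close>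
lemma newton_remainder_at_node:
  assumes f: "f holomorphic_on UNIV" and inj: "inj X"
    and X: "\<And>j. j \<le> k \<Longrightarrow> norm (X j) < R"
  shows "newton_remainder X f R k (X k) = newton_coeff X f k"
proof -
  have R0: "R > 0" using X[of k] norm_ge_zero[of "X k"] by linarith
  have hol: "f holomorphic_on cball 0 R" using f holomorphic_on_subset by blast
  define w where "w j = 1 / (\<Prod>i\<in>{..k} - {j}. X i - X j)" for j
  have "((\<lambda>t. \<Sum>j\<le>k. w j * (f t / (t - X j))) has_contour_integral
          (\<Sum>j\<le>k. w j * (2 * of_real pi * \<i> * f (X j)))) (circlepath 0 R)"
    using X hol
    by (intro has_contour_integral_sum has_contour_integral_lmul Cauchy_integral_circlepath_simple)
       auto
  moreover have "(\<Sum>j\<le>k. w j * (f t / (t - X j))) = f t / ((t - X k) * (\<Prod>j<k. X j - t))"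
    if "t \<in> path_image (circlepath 0 R)" for t
  proof -
    have "norm t = R" using that R0 by (auto simp: path_image_circlepath)
    then have t: "X j \<noteq> t" if "j \<le> k" for j using X[OF that] by auto
    have "(\<Sum>j\<le>k. w j * (f t / (t - X j))) = - f t * (\<Sum>j\<le>k. w j / (X j - t))"
      unfolding sum_distrib_left using t by (intro sum.cong) (auto simp: divide_simps algebra_simps)
    also have "(\<Sum>j\<le>k. w j / (X j - t)) = 1 / (\<Prod>i\<le>k. X i - t)"
      unfolding w_def using t inj
      by (intro partial_fractions_distinct_nodes[symmetric]) (auto intro: inj_on_subset)
    also have "(\<Prod>i\<le>k. X i - t) = - ((t - X k) * (\<Prod>j<k. X j - t))"
      by (simp add: lessThan_Suc_atMost[symmetric] algebra_simps)
    finally show ?thesis by simp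
  qed
  ultimately have "((\<lambda>t. f t / ((t - X k) * (\<Prod>j<k. X j - t))) has_contour_integral
          (\<Sum>j\<le>k. w j * (2 * of_real pi * \<i> * f (X j)))) (circlepath 0 R)"
    by (rule has_contour_integral_eq)
  then have "newton_remainder X f R k (X k) = (\<Sum>j\<le>k. w j * (2 * of_real pi * \<i> * f (X j))) / (2 * pi * \<i>)"
    by (simp add: newton_remainder_def contour_integral_unique)
  also have "\<dots> = newton_coeff X f k"
    by (simp add: newton_coeff_def w_def sum_divide_distrib)
  finally show ?thesis .
qed

lemma norm_newton_remainder_le:
  assumes f: "f holomorphic_on UNIV" and R: "norm x < R"
    and X: "\<And>j. j < n \<Longrightarrow> norm (X j) < R"
    and M: "\<And>t. norm t = R \<Longrightarrow> norm (f t) \<le> M"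
    and m: "m > 0" "\<And>t. norm t = R \<Longrightarrow> m \<le> norm (\<Prod>j<n. X j - t)"
  shows "norm (newton_remainder X f R n x) \<le> R / (R - norm x) * (M / m)"
proof -
  have R0: "R > 0" using R norm_ge_zero[of x] by linarith
  have "norm (f (of_real R)) \<le> M" using R0 by (intro M) auto
  then have M0: "M \<ge> 0" using norm_ge_zero order_trans by blast
  have "norm (2 * pi * \<i> * newton_remainder X f R n x) \<le> M / ((R - norm x) * m) * (2 * pi * R)"
  proof (rule has_contour_integral_bound_circlepath)
    show "((\<lambda>t. f t / ((t - x) * (\<Prod>j<n. X j - t))) has_contour_integral
           2 * pi * \<i> * newton_remainder X f R n x) (circlepath 0 R)"
      using newton_kernel_has_integral f R R0 X by blast
    fix t :: complex assume "norm (t - 0) = R"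
    then have t: "norm t = R" by simp
    have "R - norm x \<le> norm (t - x)" using norm_triangle_ineq2[of t x] t by simp
    then show "norm (f t / ((t - x) * (\<Prod>j<n. X j - t))) \<le> M / ((R - norm x) * m)"
      unfolding norm_divide norm_mult using R m M t M0
      by (intro frac_le mult_mono) auto
  qed (use R R0 M0 m in auto)
  then have "2 * pi * norm (newton_remainder X f R n x) \<le> 2 * pi * (R / (R - norm x) * (M / m))"
    by (simp add: norm_mult field_simps)
  then show ?thesis by (rule mult_left_le_imp_le) simp
qed

text \<open>
  At the node \<open>X m\<close> the series terminates after the term with index \<open>m\<close>, whose basis function
  is nonzero there; hence the values \<open>f (X m)\<close> determine the coefficients one after the other.
\<close>
lemma newton_series_coeffs_unique:
  fixes X a b :: "nat \<Rightarrow> complex"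
  assumes inj: "inj X"
    and a: "\<And>m. (\<lambda>n. \<Sum>k<n. a k * (\<Prod>j<k. X j - X m)) \<longlonglongrightarrow> f (X m)"
    and b: "\<And>m. (\<lambda>n. \<Sum>k<n. b k * (\<Prod>j<k. X j - X m)) \<longlonglongrightarrow> f (X m)"
  shows "a = b"
proof -
  have fin: "f (X m) = (\<Sum>k<Suc m. c k * (\<Prod>j<k. X j - X m))"
    if "\<And>m. (\<lambda>n. \<Sum>k<n. c k * (\<Prod>j<k. X j - X m)) \<longlonglongrightarrow> f (X m)" for c m
  proof -
    have "(\<lambda>k. c k * (\<Prod>j<k. X j - X m)) sums f (X m)"
      using that by (simp add: sums_def)
    moreover have "(\<lambda>k. c k * (\<Prod>j<k. X j - X m)) sums (\<Sum>k<Suc m. c k * (\<Prod>j<k. X j - X m))"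
    proof (intro sums_finite)
      fix k assume "k \<notin> {..<Suc m}"
      then have "\<exists>j\<in>{..<k}. X j - X m = 0" by (intro bexI[of _ m]) auto
      then have "(\<Prod>j<k. X j - X m) = 0" by (rule prod_zero[rotated]) simp
      then show "c k * (\<Prod>j<k. X j - X m) = 0" by simp
    qed simp
    ultimately show ?thesis using sums_unique2 by blast
  qed
  have "a n = b n" for n
  proof (induction n rule: less_induct)
    case (less n)
    have "(\<Sum>k<n. a k * (\<Prod>j<k. X j - X n)) = (\<Sum>k<n. b k * (\<Prod>j<k. X j - X n))"
      by (intro sum.cong) (auto simp: less)
    then have "a n * (\<Prod>j<n. X j - X n) = b n * (\<Prod>j<n. X j - X n)"
      using fin[of a n, OF a] fin[of b n, OF b] unfolding sum.lessThan_Suc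
      by (metis add_left_cancel)
    moreover have "(\<Prod>j<n. X j - X n) \<noteq> 0" using inj by (auto simp: inj_def)
    ultimately show ?case by (rule mult_right_cancel[THEN iffD1, rotated])
  qed
  then show ?thesis by auto
qed

section \<open>The Wilson nodes\<close>

text \<open>
  Two nodes with indices \<open>j \<noteq> k\<close> could only coincide if \<open>2 z\<^sub>0 = - (j + k) i\<close>, that is, if
  \<open>z\<^sub>0\<close> lay on the negative imaginary axis; the principal square root never does.
\<close>
lemma inj_wilson_node: "inj (wilson_node x0)"
proof
  fix j k assume "wilson_node x0 j = wilson_node x0 k"
  then have "csqrt x0 + of_nat j * \<i> = csqrt x0 + of_nat k * \<i> \<or>
      csqrt x0 + of_nat j * \<i> = - (csqrt x0 + of_nat k * \<i>)"
    unfolding wilson_node_def power2_eq_iff by simp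
  then show "j = k"
  proof
    assume "csqrt x0 + of_nat j * \<i> = - (csqrt x0 + of_nat k * \<i>)"
    then have "Re (csqrt x0) = 0" "2 * Im (csqrt x0) = - real (j + k)"
      by (auto simp: complex_eq_iff)
    moreover have "0 < Re (csqrt x0) \<or> Re (csqrt x0) = 0 \<and> 0 \<le> Im (csqrt x0)"
      by (rule csqrt_principal)
    ultimately show "j = k" by simp
  qed simp
qed

lemma wilson_node_diff:
  "wilson_node x0 i - wilson_node x0 j
     = (of_nat j - of_nat i) * (- 2 * csqrt x0 * \<i> + of_nat j + of_nat i)"
  by (simp add: wilson_node_def power2_eq_square algebra_simps)

text \<open>
  The denominators of \<open>newton_coeff\<close> are products of node differences, and each difference splits
  into a factor depending on \<open>j - i\<close> and one depending on \<open>j + i\<close>. The products of the first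
  kind give the factorials in the binomial coefficient.
\<close>
lemma prod_index_diff:
  assumes "j \<le> n"
  shows "(\<Prod>i\<in>{..n} - {j}. of_nat j - of_nat i :: complex) = (-1) ^ (n - j) * fact j * fact (n - j)"
  using assms
proof (induction rule: dec_induct)
  case base
  have "{..j} - {j} = {..<j}" by auto
  then have "(\<Prod>i\<in>{..j} - {j}. of_nat j - of_nat i :: complex) = (\<Prod>i<j. of_nat (j - i))"
    by (auto intro: prod.cong simp: of_nat_diff)
  also have "\<dots> = of_nat (\<Prod>i<j. j - i)" by simp
  also have "(\<Prod>i<j. j - i) = fact j"
    by (simp add: fact_prod_rev atLeast0LessThan)
  finally show ?case by simp
next
  case (step n)
  have "{..Suc n} - {j} = insert (Suc n) ({..n} - {j})" using step by auto
  then show ?case using step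
    by (simp add: Suc_diff_le algebra_simps of_nat_diff)
qed

text \<open>
  The factors with \<open>i < j\<close> and those with \<open>i > j\<close> form one rising factorial each. Only together
  with the omitted factor \<open>c + 2j\<close> would they join to a single one.
\<close>
lemma prod_index_sum:
  fixes c :: complex
  assumes "j \<le> n"
  shows "(\<Prod>i\<in>{..n} - {j}. c + of_nat j + of_nat i)
      = pochhammer (c + of_nat j) j * pochhammer (c + 2 * of_nat j + 1) (n - j)"
  using assms
proof (induction rule: dec_induct)
  case base
  have "{..j} - {j} = {0..<j}" by auto
  then show ?case by (simp add: pochhammer_prod)
next
  case (step n)
  have "{..Suc n} - {j} = insert (Suc n) ({..n} - {j})" using step by auto
  then show ?case using step
    by (simp add: Suc_diff_le pochhammer_Suc algebra_simps of_nat_diff)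
qed

lemma newton_coeff_wilson:
  "newton_coeff (wilson_node x0) f n = 1 / fact n *
        (\<Sum>j=0..n. (-1) ^ (n - j) * of_nat (n choose j) *
          (1 / (pochhammer (- 2 * csqrt x0 * \<i> + of_nat j) j *
                pochhammer (- 2 * csqrt x0 * \<i> + 2 * of_nat j + 1) (n - j))) *
          f (wilson_node x0 j))"
  unfolding newton_coeff_def sum_distrib_left atLeast0AtMost
proof (rule sum.cong)
  fix j assume "j \<in> {..n}"
  then have j: "j \<le> n" by simp
  define c where "c = - 2 * csqrt x0 * \<i>"
  define P where "P = pochhammer (c + of_nat j) j * pochhammer (c + 2 * of_nat j + 1) (n - j)"
  have "(\<Prod>i\<in>{..n} - {j}. wilson_node x0 i - wilson_node x0 j)
      = (\<Prod>i\<in>{..n} - {j}. of_nat j - of_nat i) * (\<Prod>i\<in>{..n} - {j}. c + of_nat j + of_nat i)"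
    by (simp add: wilson_node_diff prod.distrib c_def)
  also have "\<dots> = (-1) ^ (n - j) * fact j * fact (n - j) * P"
    by (simp only: prod_index_diff[OF j] prod_index_sum[OF j] P_def)
  finally have eq: "(\<Prod>i\<in>{..n} - {j}. wilson_node x0 i - wilson_node x0 j)
      = (-1) ^ (n - j) * fact j * fact (n - j) * P" .
  have "1 / ((-1) ^ (n - j) * fact j * fact (n - j) :: complex)
      = 1 / fact n * ((-1) ^ (n - j) * of_nat (n choose j))"
    by (simp add: binomial_fact[OF j] divide_simps flip: power_add)
  then have "f (wilson_node x0 j) / ((-1) ^ (n - j) * fact j * fact (n - j) * P)
      = 1 / fact n * ((-1) ^ (n - j) * of_nat (n choose j) * (1 / P) * f (wilson_node x0 j))"
    using j by (simp add: divide_simps)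
  then show "f (wilson_node x0 j) / (\<Prod>i\<in>{..n} - {j}. wilson_node x0 i - wilson_node x0 j)
      = 1 / fact n * ((-1) ^ (n - j) * of_nat (n choose j) *
          (1 / (pochhammer (- 2 * csqrt x0 * \<i> + of_nat j) j *
                pochhammer (- 2 * csqrt x0 * \<i> + 2 * of_nat j + 1) (n - j))) *
          f (wilson_node x0 j))"
    unfolding eq P_def c_def .
qed simp

section \<open>Bounds for the Wilson basis\<close>

lemma norm_wilson_node_le:
  assumes "norm (csqrt x0) \<le> real b"
  shows "norm (wilson_node x0 j) \<le> (real (j + b))\<^sup>2"
proof -
  have "norm (csqrt x0 + of_nat j * \<i>) \<le> norm (csqrt x0) + norm (of_nat j * \<i>)"
    by (rule norm_triangle_ineq)
  also have "\<dots> \<le> real (j + b)" using assms by (simp add: norm_mult)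
  finally show ?thesis unfolding wilson_node_def norm_power by (intro power_mono) auto
qed

text \<open>
  With \<open>|x\<^sub>j| \<le> (j + b)\<^sup>2\<close>, the distance from \<open>t\<close> to \<open>x\<^sub>j\<close> is at least
  \<open>(n + b)\<^sup>2 - (j + b)\<^sup>2 = (n - j) (n + 2b + j)\<close>. For \<open>b \<ge> 1\<close> the second factor is at least
  \<open>n + 1 + j\<close>, and the products of the two factors are then \<open>n!\<close> and at least \<open>(2n)!/n!\<close>.
\<close>
lemma wilson_basis_lower_bound:
  assumes b: "norm (csqrt x0) \<le> real b" "b \<ge> 1" and t: "norm t = (real (n + b))\<^sup>2"
  shows "fact (2 * n) \<le> norm (\<Prod>j<n. wilson_node x0 j - t)"
proof -
  have "(fact (2 * n) :: real) = fact n * (\<Prod>j<n. real (n + 1 + j))"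
  proof -
    have "(fact (n + n) :: real) = fact n * pochhammer (1 + of_nat n) n"
      by (simp only: pochhammer_fact pochhammer_product'[of 1 n n])
    then show ?thesis
      by (simp add: pochhammer_prod atLeast0LessThan mult_2 add.assoc add.left_commute add.commute)
  qed
  also have "\<dots> = (\<Prod>j<n. real (n - j)) * (\<Prod>j<n. real (n + 1 + j))"
    by (simp add: fact_prod_rev atLeast0LessThan)
  also have "\<dots> = (\<Prod>j<n. real (n - j) * real (n + 1 + j))"
    by (simp add: prod.distrib)
  also have "\<dots> \<le> (\<Prod>j<n. norm (wilson_node x0 j - t))"
  proof (intro prod_mono conjI)
    fix j assume "j \<in> {..<n}"
    then have j: "j < n" by simp
    have "real (n - j) * real (n + 1 + j) \<le> real (n - j) * real (n + 2 * b + j)"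
      using b by (intro mult_left_mono) auto
    also have "\<dots> = (real (n + b))\<^sup>2 - (real (j + b))\<^sup>2"
      using j by (simp add: of_nat_diff power2_eq_square algebra_simps)
    also have "\<dots> \<le> norm t - norm (wilson_node x0 j)"
      using norm_wilson_node_le[OF b(1), of j] t by simp
    also have "\<dots> \<le> norm (wilson_node x0 j - t)"
      by (metis norm_minus_commute norm_triangle_ineq2)
    finally show "real (n - j) * real (n + 1 + j) \<le> norm (wilson_node x0 j - t)" .
  qed simp
  finally show ?thesis by (simp add: prod_norm)
qed

lemma fact_add_le_power: "fact (n + B) \<le> fact n * real (n + B) ^ B"
proof (induction B)
  case (Suc B)
  have "fact (n + Suc B) = real (n + Suc B) * fact (n + B)" by simp
  also have "\<dots> \<le> real (n + Suc B) * (fact n * real (n + B) ^ B)"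
    by (intro mult_left_mono Suc) auto
  also have "\<dots> \<le> real (n + Suc B) * (fact n * real (n + Suc B) ^ B)"
    by (intro mult_left_mono power_mono) auto
  finally show ?case by (simp add: algebra_simps)
qed simp

text \<open>
  Since \<open>|x\<^sub>j - x| \<le> (j + b)\<^sup>2 + c\<^sup>2 \<le> (j + b + c)\<^sup>2\<close>, the product is dominated by the square of a
  shifted factorial, and a fixed shift costs only a power of \<open>n\<close>.
\<close>
lemma wilson_basis_upper_bound:
  assumes "norm (csqrt x0) \<le> real b" and x: "norm x \<le> real c ^ 2"
  shows "norm (\<Prod>j<n. wilson_node x0 j - x) \<le> (fact n * real (n + (b + c)) ^ (b + c))\<^sup>2"
proof -
  have "norm (\<Prod>j<n. wilson_node x0 j - x) = (\<Prod>j<n. norm (wilson_node x0 j - x))"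
    by (simp add: prod_norm)
  also have "\<dots> \<le> (\<Prod>j<n. (real (1 + (b + c) + j))\<^sup>2)"
  proof (intro prod_mono conjI)
    fix j
    have "norm (wilson_node x0 j - x) \<le> norm (wilson_node x0 j) + norm x"
      by (rule norm_triangle_ineq4)
    also have "\<dots> \<le> real (j + b) ^ 2 + real c ^ 2"
      using norm_wilson_node_le[OF assms(1), of j] x by simp
    also have "\<dots> \<le> real (j + b + c) ^ 2"
      by (simp add: power2_eq_square algebra_simps)
    also have "\<dots> \<le> (real (1 + (b + c) + j))\<^sup>2" by (intro power_mono) auto
    finally show "norm (wilson_node x0 j - x) \<le> (real (1 + (b + c) + j))\<^sup>2" .
  qed simp
  also have "\<dots> = (pochhammer (1 + real (b + c)) n)\<^sup>2"
    by (simp add: pochhammer_prod atLeast0LessThan add.assoc flip: prod_power_distrib)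
  also have "\<dots> \<le> (fact n * real (n + (b + c)) ^ (b + c))\<^sup>2"
  proof (intro power_mono)
    have "fact (b + c + n) = (fact (b + c) :: real) * pochhammer (1 + real (b + c)) n"
      by (simp only: pochhammer_fact pochhammer_product'[of 1 "b + c" n])
    moreover have "(1::real) * pochhammer (1 + real (b + c)) n \<le> fact (b + c) * pochhammer (1 + real (b + c)) n"
      by (intro mult_right_mono fact_ge_1) (simp add: pochhammer_nonneg)
    ultimately have "pochhammer (1 + real (b + c)) n \<le> fact (n + (b + c))"
      by (simp add: ac_simps)
    then show "pochhammer (1 + real (b + c)) n \<le> fact n * real (n + (b + c)) ^ (b + c)"
      using fact_add_le_power[of n "b + c"] by linarith
  qed (simp add: pochhammer_nonneg)
  finally show ?thesis .
qed

section \<open>Convergence for functions of small growth\<close>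

text \<open>
  This is where the constant \<open>2 ln 2\<close> enters: \<open>(n!)\<^sup>2/(2n)!\<close> is the reciprocal of a central
  binomial coefficient, hence at most \<open>2n/4\<^sup>n\<close>, and \<open>exp (\<sigma> n)/4\<^sup>n\<close> decays exponentially.
  The shape of the sequence is the product of the upper bound for the basis on a compact set and
  the bound for the remainder integral.
\<close>
lemma wilson_error_bound_tendsto_0:
  fixes \<sigma> :: real and b B :: nat
  assumes "\<sigma> < 2 * ln 2"
  shows "(\<lambda>n. (fact n * real (n + B) ^ B)\<^sup>2 * (2 * (exp (\<sigma> * real (n + b)) / fact (2 * n)))) \<longlonglongrightarrow> 0"
proof (rule Lim_null_comparison)
  define d where "d = 2 * ln 2 - \<sigma>"
  have "d > 0" using assms by (simp add: d_def)
  show "(\<lambda>n. 4 * exp (\<sigma> * real b) * (real n * (real n + real B) ^ (2 * B) * exp (- d * real n))) \<longlonglongrightarrow> 0"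
  proof -
    have "((\<lambda>x. x * (x + real B) ^ (2 * B) * exp (- d * x)) \<longlongrightarrow> 0) at_top"
      using \<open>d > 0\<close> by real_asymp
    then have "(\<lambda>n. real n * (real n + real B) ^ (2 * B) * exp (- d * real n)) \<longlonglongrightarrow> 0"
      by (rule filterlim_compose[OF _ filterlim_real_sequentially])
    then show ?thesis by (rule tendsto_mult_right_zero)
  qed
  show "\<forall>\<^sub>F n in sequentially.
     norm ((fact n * real (n + B) ^ B)\<^sup>2 * (2 * (exp (\<sigma> * real (n + b)) / fact (2 * n))))
      \<le> 4 * exp (\<sigma> * real b) * (real n * (real n + real B) ^ (2 * B) * exp (- d * real n))"
    using eventually_gt_at_top[of 0]
  proof eventually_elim
    case (elim n)
    have "4 ^ n / (2 * real n) \<le> real ((2 * n) choose n)"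
      using elim by (intro central_binomial_lower_bound) auto
    also have "\<dots> = fact (2 * n) / (fact n)\<^sup>2"
      by (simp add: binomial_fact power2_eq_square mult_2)
    finally have ratio: "(fact n)\<^sup>2 / fact (2 * n) \<le> 2 * real n / 4 ^ n"
      using elim by (simp add: field_simps)
    have "(4::real) ^ n = exp (2 * ln 2 * real n)"
      by (simp add: exp_of_nat2_mult exp_double)
    then have exp_ratio: "exp (\<sigma> * real (n + b)) / 4 ^ n = exp (\<sigma> * real b) * exp (- d * real n)"
      by (simp add: d_def algebra_simps flip: exp_add exp_diff)
    have "norm ((fact n * real (n + B) ^ B)\<^sup>2 * (2 * (exp (\<sigma> * real (n + b)) / fact (2 * n))))
        = (fact n)\<^sup>2 / fact (2 * n) * (2 * exp (\<sigma> * real (n + b)) * real (n + B) ^ (2 * B))"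
      by (simp add: power_mult_distrib power_even_eq abs_mult)
    also have "\<dots> \<le> 2 * real n / 4 ^ n * (2 * exp (\<sigma> * real (n + b)) * real (n + B) ^ (2 * B))"
      by (intro mult_right_mono ratio) auto
    also have "\<dots> = 4 * real n * real (n + B) ^ (2 * B) * (exp (\<sigma> * real (n + b)) / 4 ^ n)"
      by simp
    also have "\<dots> = 4 * exp (\<sigma> * real b) * (real n * (real n + real B) ^ (2 * B) * exp (- d * real n))"
      unfolding exp_ratio by simp
    finally show ?case .
  qed
qed

text \<open>
  The strict inequality leaves room for a \<open>\<sigma>\<close> above the upper limit, which bounds the
  quotients themselves for all large radii.
\<close>
lemma growth_bound_from_Limsup:
  assumes f: "f holomorphic_on UNIV"
    and "Limsup at_top (\<lambda>r::real. ereal (ln_plus (max_modulus r f) / sqrt r)) < ereal T"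
  obtains \<sigma> where "\<sigma> < T"
    "\<forall>\<^sub>F r in at_top. \<forall>t. norm t = r \<longrightarrow> norm (f t) \<le> exp (\<sigma> * sqrt r)"
proof -
  obtain s where s: "Limsup at_top (\<lambda>r::real. ereal (ln_plus (max_modulus r f) / sqrt r)) < s" "s < ereal T"
    using assms(2) dense by blast
  (* s is an extended real and may be - \<infinity>; any real number below T serves in that case. *)
  obtain \<sigma> where \<sigma>: "s \<le> ereal \<sigma>" "\<sigma> < T"
    using s(2) by (cases s) (auto intro: that[of "T - 1"])
  have "Limsup at_top (\<lambda>r::real. ereal (ln_plus (max_modulus r f) / sqrt r)) < ereal \<sigma>"
    using s \<sigma> by simp
  then have "\<forall>\<^sub>F r in at_top. ereal (ln_plus (max_modulus r f) / sqrt r) < ereal \<sigma>"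
    by (rule Limsup_lessD)
  then have "\<forall>\<^sub>F r in at_top. \<forall>t. norm t = r \<longrightarrow> norm (f t) \<le> exp (\<sigma> * sqrt r)"
    using eventually_gt_at_top[of 0]
  proof eventually_elim
    case (elim r)
    show ?case
    proof (intro allI impI)
      fix t :: complex assume t: "norm t = r"
      have "continuous_on (sphere 0 r) (\<lambda>x. norm (f x))"
        using f holomorphic_on_imp_continuous_on continuous_on_subset
        by (intro continuous_on_norm) blast
      then have "bdd_above ((\<lambda>x. norm (f x)) ` sphere 0 r)"
        by (intro compact_imp_bounded[THEN bounded_imp_bdd_above] compact_continuous_image) auto
      then have le: "norm (f t) \<le> max_modulus r f"
        unfolding max_modulus_def using t by (intro cSUP_upper) auto
      show "norm (f t) \<le> exp (\<sigma> * sqrt r)"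
      proof (cases "f t = 0")
        case False
        then have pos: "max_modulus r f > 0" using le by (smt (verit) zero_less_norm_iff)
        then have "ln (max_modulus r f) \<le> ln_plus (max_modulus r f)" by (simp add: ln_plus_def)
        also have "\<dots> \<le> \<sigma> * sqrt r" using elim by (simp add: field_simps)
        finally show ?thesis using le pos by (metis exp_le_cancel_iff exp_ln order_trans)
      qed simp
    qed
  qed
  with \<sigma> that show ?thesis by blast
qed

text \<open>
  For each \<open>n\<close> the remainder formula is applied on the circle of radius \<open>R n = (n + b)\<^sup>2\<close>. On
  it \<open>\<surd>t\<close> has modulus \<open>n + b\<close>, so that the growth of \<open>f\<close> and the lower bound for the basis
  can be compared directly.
\<close>
lemma wilson_series_of_small_growth_converges:
  assumes f: "f holomorphic_on UNIV" and "\<sigma> < 2 * ln 2"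
    and growth: "\<forall>\<^sub>F r in at_top. \<forall>t. norm t = r \<longrightarrow> norm (f t) \<le> exp (\<sigma> * sqrt r)"
  shows "wilson_series_converges_to (newton_coeff (wilson_node x0) f) x0 f"
  unfolding wilson_series_converges_to_def
proof (intro allI impI)
  fix K :: "complex set" assume "compact K"
  then have "bounded K" by (rule compact_imp_bounded)
  then obtain \<rho> where \<rho>: "\<forall>x\<in>K. norm x \<le> \<rho>" unfolding bounded_iff by blast
  obtain b0 :: nat where "norm (csqrt x0) \<le> real b0" using real_arch_simple by blast
  (* The lower bound for the basis on the circle needs b to be at least 1, also when x0 = 0. *)
  then obtain b :: nat where b: "norm (csqrt x0) \<le> real b" "b \<ge> 1"
    using that[of "Suc b0"] by simp
  obtain c :: nat where c: "\<rho> \<le> real c" using real_arch_simple by blast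
  have cK: "norm x \<le> real c ^ 2" if "x \<in> K" for x
  proof -
    have "norm x \<le> real c" using \<rho> that c by (blast intro: order_trans)
    also have "\<dots> \<le> real (c ^ 2)" unfolding of_nat_le_iff by (simp add: power2_eq_square)
    finally show ?thesis by simp
  qed
  define R where "R n = (real (n + b))\<^sup>2" for n
  define E where "E n = (fact n * real (n + (b + c)) ^ (b + c))\<^sup>2
      * (2 * (exp (\<sigma> * real (n + b)) / fact (2 * n)))" for n
  have "filterlim R at_top sequentially" unfolding R_def of_nat_add by real_asymp
  then have "\<forall>\<^sub>F n in sequentially. \<forall>t. norm t = R n \<longrightarrow> norm (f t) \<le> exp (\<sigma> * sqrt (R n))"
    and "\<forall>\<^sub>F n in sequentially. 2 * real c ^ 2 < R n"
    using eventually_compose_filterlim growth eventually_gt_at_top by blast+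
  then have error: "\<forall>\<^sub>F n in sequentially. \<forall>x\<in>K.
      norm ((\<Sum>k<n. newton_coeff (wilson_node x0) f k * wilson_basis k x x0) - f x) \<le> E n"
  proof eventually_elim
    case (elim n)
    show ?case
    proof
      fix x assume "x \<in> K"
      (* Keeping x in the half-size disc makes R n / (R n - norm x) at most 2. *)
      have x: "2 * norm x < R n" using cK[OF \<open>x \<in> K\<close>] elim by linarith
      then have xR: "norm x < R n" using norm_ge_zero[of x] by linarith
      have node: "norm (wilson_node x0 j) < R n" if "j < n" for j
      proof -
        have "(real (j + b))\<^sup>2 < (real (n + b))\<^sup>2" using that by (intro power_strict_mono) auto
        then show ?thesis using norm_wilson_node_le[OF b(1), of j] by (simp add: R_def)
      qed
      have "f x = (\<Sum>k<n. newton_remainder (wilson_node x0) f (R n) k (wilson_node x0 k)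
                  * wilson_basis k x x0)
               + (\<Prod>j<n. wilson_node x0 j - x) * newton_remainder (wilson_node x0) f (R n) n x"
        unfolding wilson_basis_def using f xR node by (rule newton_expansion_with_remainder)
      also have "(\<Sum>k<n. newton_remainder (wilson_node x0) f (R n) k (wilson_node x0 k)
                  * wilson_basis k x x0)
          = (\<Sum>k<n. newton_coeff (wilson_node x0) f k * wilson_basis k x x0)"
        by (intro sum.cong refl arg_cong2[where f = "(*)"] newton_remainder_at_node f inj_wilson_node)
           (use node in auto)
      finally have "norm ((\<Sum>k<n. newton_coeff (wilson_node x0) f k * wilson_basis k x x0) - f x)
          = norm (\<Prod>j<n. wilson_node x0 j - x) * norm (newton_remainder (wilson_node x0) f (R n) n x)"
        by (simp add: norm_mult)
      also have "\<dots> \<le> (fact n * real (n + (b + c)) ^ (b + c))\<^sup>2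
          * (2 * (exp (\<sigma> * real (n + b)) / fact (2 * n)))"
      proof (intro mult_mono)
        show "norm (\<Prod>j<n. wilson_node x0 j - x) \<le> (fact n * real (n + (b + c)) ^ (b + c))\<^sup>2"
          using b(1) cK[OF \<open>x \<in> K\<close>] by (rule wilson_basis_upper_bound)
        have "norm (newton_remainder (wilson_node x0) f (R n) n x)
            \<le> R n / (R n - norm x) * (exp (\<sigma> * real (n + b)) / fact (2 * n))"
        proof (rule norm_newton_remainder_le[OF f xR node])
          fix t :: complex assume t: "norm t = R n"
          show "norm (f t) \<le> exp (\<sigma> * real (n + b))"
            using elim(1) t by (auto simp: R_def)
          show "fact (2 * n) \<le> norm (\<Prod>j<n. wilson_node x0 j - t)"
            using t by (intro wilson_basis_lower_bound[OF b]) (simp add: R_def)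
        qed auto
        also have "R n / (R n - norm x) \<le> 2" using x xR by (simp add: field_simps)
        finally show "norm (newton_remainder (wilson_node x0) f (R n) n x)
            \<le> 2 * (exp (\<sigma> * real (n + b)) / fact (2 * n))"
          by (simp add: mult_right_mono divide_right_mono)
      qed auto
      finally show "norm ((\<Sum>k<n. newton_coeff (wilson_node x0) f k * wilson_basis k x x0) - f x) \<le> E n"
        by (simp add: E_def)
    qed
  qed
  have "E \<longlonglongrightarrow> 0"
    unfolding E_def using wilson_error_bound_tendsto_0[OF \<open>\<sigma> < 2 * ln 2\<close>] .
  show "uniform_limit K (\<lambda>n x. \<Sum>k<n. newton_coeff (wilson_node x0) f k * wilson_basis k x x0)
          f sequentially"
    unfolding uniform_limit_iff
  proof (intro allI impI)
    fix e :: real assume "e > 0"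
    then have "\<forall>\<^sub>F n in sequentially. E n < e" using \<open>E \<longlonglongrightarrow> 0\<close> by (rule order_tendstoD(2)[rotated])
    with error show "\<forall>\<^sub>F n in sequentially. \<forall>x\<in>K.
        dist (\<Sum>k<n. newton_coeff (wilson_node x0) f k * wilson_basis k x x0) (f x) < e"
      by eventually_elim (force simp: dist_norm)
  qed
qed

theorem theorem2p10:
  fixes x0 :: complex and f :: "complex \<Rightarrow> complex"
  assumes "f holomorphic_on UNIV"
    and "Limsup at_top (\<lambda>r::real. ereal (ln_plus (max_modulus r f) / sqrt r)) < ereal (2 * ln 2)"
  shows "(\<exists>!a. wilson_series_converges_to a x0 f) \<and>
    (\<forall>a. wilson_series_converges_to a x0 f \<longrightarrow>
      (\<forall>n. a n = 1 / fact n *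
        (\<Sum>j=0..n. (-1) ^ (n - j) * of_nat (n choose j) *
          (1 / (pochhammer (- 2 * csqrt x0 * \<i> + of_nat j) j *
                pochhammer (- 2 * csqrt x0 * \<i> + 2 * of_nat j + 1) (n - j))) *
          f (wilson_node x0 j))))"
proof -
  obtain \<sigma> where "\<sigma> < 2 * ln 2"
    "\<forall>\<^sub>F r in at_top. \<forall>t. norm t = r \<longrightarrow> norm (f t) \<le> exp (\<sigma> * sqrt r)"
    using growth_bound_from_Limsup[OF assms] .
  then have ex: "wilson_series_converges_to (newton_coeff (wilson_node x0) f) x0 f"
    by (rule wilson_series_of_small_growth_converges[OF assms(1)])
  have at_node: "(\<lambda>n. \<Sum>k<n. a k * (\<Prod>j<k. wilson_node x0 j - wilson_node x0 m))
        \<longlonglongrightarrow> f (wilson_node x0 m)" if "wilson_series_converges_to a x0 f" for a m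
  proof -
    have "uniform_limit {wilson_node x0 m} (\<lambda>n x. \<Sum>k<n. a k * wilson_basis k x x0) f sequentially"
      using that unfolding wilson_series_converges_to_def
      by (elim allE[of _ "{wilson_node x0 m}"] impE) simp_all
    then show ?thesis
      unfolding wilson_basis_def by (rule tendsto_uniform_limitI) simp
  qed
  have uniq: "a = newton_coeff (wilson_node x0) f" if "wilson_series_converges_to a x0 f" for a
    using inj_wilson_node at_node[OF that] at_node[OF ex] by (rule newton_series_coeffs_unique)
  show ?thesis
  proof (intro conjI ex1I allI impI)
    show "wilson_series_converges_to (newton_coeff (wilson_node x0) f) x0 f" by (rule ex)
  next
    fix a n assume "wilson_series_converges_to a x0 f"
    then have "a = newton_coeff (wilson_node x0) f" by (rule uniq)
    then show "a n = 1 / fact n *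
        (\<Sum>j=0..n. (-1) ^ (n - j) * of_nat (n choose j) *
          (1 / (pochhammer (- 2 * csqrt x0 * \<i> + of_nat j) j *
                pochhammer (- 2 * csqrt x0 * \<i> + 2 * of_nat j + 1) (n - j))) *
          f (wilson_node x0 j))"
      by (simp only: newton_coeff_wilson)
  qed (rule uniq)
qed

end
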